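(* If $T\in\mathcal{O}_H'(\mathbb{R}^d)$ and $\operatorname{supp}T\subset W_\varepsilon$ for some $\varepsilon>0$, then $T\in\mathcal{D}_H'(\mathbb{R}^d)$.
   Context: $\mathbb{R}_*=\mathbb{R}\setminus\{0\}$; $\xi y$ is the coordinatewise product. $W_\varepsilon=\{x\in\mathbb{R}^d:\min_j|x_j|\ge\varepsilon\}$. Euler derivatives: $\theta_j=x_j\partial_j$, $\theta^\beta=\theta_1^{\beta_1}\cdots\theta_d^{\beta_d}$. $\mathcal{O}_H'(\mathbb{R}^d)$ is the set of $T\in\mathcal{D}'(\mathbb{R}^d)$ such that for every $k\in\mathbb{N}_0$ there are finitely many measurable functions $t_\beta$ with $(1+|x|^2)^{k/2}t_\beta\in L_\infty(\mathbb{R}^d)$ and $T=\sum_\beta\theta^\beta t_\beta$. $\mathcal{D}_H'(\mathbb{R}^d)$ is the set of $T\in\mathcal{D}'(\mathbb{R}^d)$ such that for every $\varphi\in\mathcal{D}(\mathbb{R}^d)$ the function $y\mapsto T_\xi\varphi(\xi y)$, $y\in\mathbb{R}_*^d$, is the restriction of a function in $\mathcal{D}(\mathbb{R}^d)$. *)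

theory Defs
  imports "HOL-Analysis.Analysis"
begin

definition partial :: "'n::finite \<Rightarrow> (real^'n \<Rightarrow> complex) \<Rightarrow> real^'n \<Rightarrow> complex" where
  "partial j f x = frechet_derivative f (at x) (axis j 1)"

fun iter_partial :: "'n::finite list \<Rightarrow> (real^'n \<Rightarrow> complex) \<Rightarrow> real^'n \<Rightarrow> complex" where
  "iter_partial [] f = f"
| "iter_partial (j # js) f = partial j (iter_partial js f)"

definition smooth :: "(real^'n::finite \<Rightarrow> complex) \<Rightarrow> bool" where
  "smooth f \<longleftrightarrow> (\<forall>js x. iter_partial js f differentiable (at x))"

definition tsupp :: "(real^'n::finite \<Rightarrow> complex) \<Rightarrow> (real^'n) set" where
  "tsupp f = closure {x. f x \<noteq> 0}"

definition test_fun :: "(real^'n::finite \<Rightarrow> complex) set" where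
  "test_fun = {f. smooth f \<and> compact (tsupp f)}"

definition test_seminorm :: "nat \<Rightarrow> (real^'n::finite \<Rightarrow> complex) \<Rightarrow> real" where
  "test_seminorm N f = (\<Sum>js\<in>{js::'n list. length js \<le> N}. SUP x. norm (iter_partial js f x))"

definition distribution :: "((real^'n::finite \<Rightarrow> complex) \<Rightarrow> complex) \<Rightarrow> bool" where
  "distribution T \<longleftrightarrow>
     (\<forall>f\<in>test_fun. \<forall>g\<in>test_fun. T (\<lambda>x. f x + g x) = T f + T g) \<and>
     (\<forall>f\<in>test_fun. \<forall>c. T (\<lambda>x. c * f x) = c * T f) \<and>
     (\<forall>K. compact K \<longrightarrow> (\<exists>C N. \<forall>f\<in>test_fun. tsupp f \<subseteq> K \<longrightarrow> norm (T f) \<le> C * test_seminorm N f))"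

definition dsupp :: "((real^'n::finite \<Rightarrow> complex) \<Rightarrow> complex) \<Rightarrow> (real^'n) set" where
  "dsupp T = {x. \<not> (\<exists>U. open U \<and> x \<in> U \<and> (\<forall>f\<in>test_fun. tsupp f \<subseteq> U \<longrightarrow> T f = 0))}"

definition W :: "real \<Rightarrow> (real^'n::finite) set" where
  "W \<epsilon> = {x. \<forall>j. \<epsilon> \<le> \<bar>x $ j\<bar>}"

text \<open>Transpose of the Euler operator theta_j = x_j d_j:  phi |-> -(phi + x_j d_j phi).\<close>
definition euler_adj :: "'n::finite \<Rightarrow> (real^'n \<Rightarrow> complex) \<Rightarrow> real^'n \<Rightarrow> complex" where
  "euler_adj j f x = - (f x + of_real (x $ j) * partial j f x)"

fun iter_euler_adj :: "'n::finite list \<Rightarrow> (real^'n \<Rightarrow> complex) \<Rightarrow> real^'n \<Rightarrow> complex" where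
  "iter_euler_adj [] f = f"
| "iter_euler_adj (j # js) f = euler_adj j (iter_euler_adj js f)"

text \<open>O_H'(R^d): for every k, T = sum over finitely many multi-indices (encoded as lists of
  coordinate indices, theta_js = product of theta_j for j in js) of theta^beta t_beta, with
  t_beta measurable and (1+|x|^2)^(k/2) t_beta essentially bounded; the equality is in the
  sense of distributions.\<close>
definition OH :: "((real^'n::finite \<Rightarrow> complex) \<Rightarrow> complex) set" where
  "OH = {T. distribution T \<and>
     (\<forall>k::nat. \<exists>(F::'n list set) (t::'n list \<Rightarrow> real^'n \<Rightarrow> complex).
        finite F \<and>
        (\<forall>js\<in>F. t js \<in> borel_measurable lborel \<and>
           (\<exists>C. AE x in lborel. (1 + norm x ^ 2) powr (real k / 2) * norm (t js x) \<le> C)) \<and>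
        (\<forall>f\<in>test_fun. T f = (\<Sum>js\<in>F. integral\<^sup>L lborel (\<lambda>x. t js x * iter_euler_adj js f x))))}"

definition coord_mult :: "real^'n::finite \<Rightarrow> real^'n \<Rightarrow> real^'n" where
  "coord_mult a b = (\<chi> j. a $ j * b $ j)"

definition DH :: "((real^'n::finite \<Rightarrow> complex) \<Rightarrow> complex) set" where
  "DH = {T. distribution T \<and>
     (\<forall>\<phi>\<in>test_fun. \<exists>\<psi>\<in>test_fun. \<forall>y. (\<forall>j. y $ j \<noteq> 0) \<longrightarrow>
         T (\<lambda>\<xi>. \<phi> (coord_mult \<xi> y)) = \<psi> y)}"

end

theory Submission
  imports Defs "HOL-Probability.Sinc_Integral"
begin

text \<open>
  Euler operators commute with coordinatewise dilations, so a representation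
  \<open>T = \<Sum> \<theta>\<^sup>\<beta> t\<^sub>\<beta>\<close> gives \<open>T\<^sub>\<xi> \<phi>(\<xi> y) = \<Sum> \<integral> t\<^sub>\<beta>(\<xi>) \<phi>\<^sub>\<beta>(\<xi> y) d\<xi>\<close> with test functions \<open>\<phi>\<^sub>\<beta>\<close>
  obtained from \<open>\<phi>\<close> by transposed Euler operators. The right-hand side makes sense for
  every \<open>y\<close>, and each derivative in \<open>y\<^sub>j\<close> costs one factor \<open>\<xi>\<^sub>j\<close>, that is, one order of decay of \<open>t\<^sub>\<beta>\<close>;
  hence it is \<open>N\<close> times differentiable once the decay is fast enough. The extensions for different
  \<open>N\<close> are continuous and agree on the dense set where no coordinate vanishes, so they coincide
  and are smooth. If \<open>\<phi>\<close> vanishes where some coordinate exceeds \<open>R\<close> and \<open>|y\<^sub>i| > R / \<epsilon>\<close>, then the support of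
  \<open>\<xi> \<mapsto> \<phi>(\<xi> y)\<close> misses \<open>W \<epsilon>\<close>, and \<open>T\<close> annihilates it; so the extension has compact support.
\<close>

subsection \<open>Calculus of iterated partial derivatives\<close>

text \<open>A single representation of \<open>T\<close> controls only finitely many derivatives, so
  smoothness is graded by order. Unlike \<open>iter_partial\<close>, the recursion differentiates
  \<open>f\<close> first; product and quotient rules then rewrite \<open>partial j f\<close> and the
  induction hypothesis applies to the result.\<close>

fun differentiable_upto :: "nat \<Rightarrow> (real^'n::finite \<Rightarrow> complex) \<Rightarrow> bool" where
  "differentiable_upto 0 f \<longleftrightarrow> (\<forall>x. f differentiable (at x))"
| "differentiable_upto (Suc n) f \<longleftrightarrow>
     (\<forall>x. f differentiable (at x)) \<and> (\<forall>j. differentiable_upto n (partial j f))"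

lemma differentiable_upto_imp_differentiable:
  "differentiable_upto n f \<Longrightarrow> f differentiable (at x)"
  by (cases n) auto

lemma differentiable_upto_Suc_lower:
  "differentiable_upto (Suc n) f \<Longrightarrow> differentiable_upto n f"
  by (induction n arbitrary: f) auto

lemma iter_partial_append:
  "iter_partial (js @ ks) f = iter_partial js (iter_partial ks f)"
  by (induction js) auto

lemma differentiable_upto_iff_iter_partial:
  "differentiable_upto n f \<longleftrightarrow>
     (\<forall>js x. length js \<le> n \<longrightarrow> iter_partial js f differentiable (at x))"
proof (induction n arbitrary: f)
  case (Suc n)
  show ?case (is "_ \<longleftrightarrow> ?R")
  proof
    assume L: "differentiable_upto (Suc n) f"
    show ?R
    proof (intro allI impI)
      fix js :: "'a list" and x
      assume len: "length js \<le> Suc n"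
      show "iter_partial js f differentiable (at x)"
      \<comment> \<open>\<open>iter_partial\<close> applies the last index first, so the list is
        split at its end to expose the derivative that \<open>differentiable_upto\<close> takes
        first.\<close>
      proof (cases js rule: rev_cases)
        case Nil
        then show ?thesis using L by simp
      next
        case (snoc ks j)
        then show ?thesis using L Suc.IH len by (auto simp: iter_partial_append)
      qed
    qed
  next
    assume R: ?R
    have "iter_partial (js @ [j]) f differentiable (at x)" if "length js \<le> n" for js j x
      using R that by (metis Suc_le_mono length_append_singleton)
    moreover have "f differentiable (at x)" for x
      using R[rule_format, of "[]"] by simp
    ultimately show "differentiable_upto (Suc n) f"
      using Suc.IH by (auto simp: iter_partial_append)
  qed
qed auto

lemma smooth_iff_differentiable_upto: "smooth f \<longleftrightarrow> (\<forall>n. differentiable_upto n f)"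
  by (auto simp: smooth_def differentiable_upto_iff_iter_partial)

lemma smooth_imp_differentiable: "smooth f \<Longrightarrow> f differentiable (at x)"
  using smooth_iff_differentiable_upto differentiable_upto_imp_differentiable by blast

lemma smooth_partial: "smooth f \<Longrightarrow> smooth (partial j f)"
  by (metis differentiable_upto.simps(2) smooth_iff_differentiable_upto)

lemma partial_eqI: "(f has_derivative f') (at x) \<Longrightarrow> partial j f x = f' (axis j 1)"
  using frechet_derivative_at by (fastforce simp: partial_def)

lemma frechet_derivative_works_at:
  "f differentiable (at x) \<Longrightarrow> (f has_derivative frechet_derivative f (at x)) (at x)"
  by (simp add: frechet_derivative_works)

lemma has_derivative_partial_sum:
  fixes f :: "real^'n::finite \<Rightarrow> complex"
  assumes "f differentiable (at x)"
  shows "(f has_derivative (\<lambda>h. \<Sum>j\<in>UNIV. of_real (h $ j) * partial j f x)) (at x)"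
proof -
  let ?D = "frechet_derivative f (at x)"
  have D: "(f has_derivative ?D) (at x)"
    using assms by (rule frechet_derivative_works_at)
  then have lin: "linear ?D" by (rule has_derivative_linear)
  have "?D h = (\<Sum>j\<in>UNIV. of_real (h $ j) * partial j f x)" for h
  proof -
    have "?D h = ?D (\<Sum>j\<in>UNIV. h $ j *s axis j 1)"
      by (simp add: basis_expansion)
    also have "\<dots> = (\<Sum>j\<in>UNIV. h $ j *\<^sub>R ?D (axis j 1))"
      by (simp add: linear_sum[OF lin] linear_scale[OF lin] scalar_mult_eq_scaleR)
    finally show ?thesis by (simp add: partial_def scaleR_conv_of_real)
  qed
  then show ?thesis using D by (metis (no_types, lifting) ext)
qed

lemma partial_add:
  assumes "f differentiable (at x)" "g differentiable (at x)"
  shows "partial j (\<lambda>x. f x + g x) x = partial j f x + partial j g x"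
  using partial_eqI[OF has_derivative_add[OF assms[THEN frechet_derivative_works_at]]]
  by (simp add: partial_def)

lemma partial_mult:
  assumes "f differentiable (at x)" "g differentiable (at x)"
  shows "partial j (\<lambda>x. f x * g x) x = f x * partial j g x + partial j f x * g x"
  using partial_eqI[OF has_derivative_mult[OF assms[THEN frechet_derivative_works_at]]]
  by (simp add: partial_def)

text \<open>The right-hand side is spelled out as a product with the constant \<open>- 1\<close>, so
  that closure under constants and products carries the induction in
  \<open>differentiable_upto_inverse\<close>.\<close>

lemma partial_inverse:
  assumes "f differentiable (at x)" "f x \<noteq> 0"
  shows "partial j (\<lambda>x. inverse (f x)) x = - 1 * (inverse (f x) * (inverse (f x) * partial j f x))"
  using partial_eqI[OF Deriv.has_derivative_inverse[OF assms(2) assms(1)[THEN frechet_derivative_works_at]]]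
  by (simp add: partial_def)

lemma partial_const: "partial j (\<lambda>x. c) x = 0"
  by (rule partial_eqI[OF has_derivative_const])

lemma differentiable_upto_const: "differentiable_upto n (\<lambda>x. c)"
  by (induction n arbitrary: c) (simp_all add: partial_const[abs_def])

lemma differentiable_upto_add:
  assumes "differentiable_upto n f" "differentiable_upto n g"
  shows "differentiable_upto n (\<lambda>x. f x + g x)"
  using assms
proof (induction n arbitrary: f g)
  case (Suc n)
  then have "partial j (\<lambda>x. f x + g x) = (\<lambda>x. partial j f x + partial j g x)" for j
    by (auto simp: partial_add)
  with Suc show ?case by auto
qed auto

lemma differentiable_upto_mult:
  assumes "differentiable_upto n f" "differentiable_upto n g"
  shows "differentiable_upto n (\<lambda>x. f x * g x)"
  using assms
proof (induction n arbitrary: f g)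
  case (Suc n)
  then have "partial j (\<lambda>x. f x * g x) = (\<lambda>x. f x * partial j g x + partial j f x * g x)" for j
    by (auto simp: partial_mult)
  moreover have "differentiable_upto n f" "differentiable_upto n g"
    using Suc.prems differentiable_upto_Suc_lower by blast+
  ultimately show ?case using Suc by (auto intro!: differentiable_upto_add)
qed auto

lemma differentiable_upto_inverse:
  assumes "differentiable_upto n f" "\<And>x. f x \<noteq> 0"
  shows "differentiable_upto n (\<lambda>x. inverse (f x))"
  using assms
proof (induction n arbitrary: f)
  case (Suc n)
  then have "partial j (\<lambda>x. inverse (f x)) =
      (\<lambda>x. - 1 * (inverse (f x) * (inverse (f x) * partial j f x)))" for j
    by (auto simp: partial_inverse)
  moreover have "differentiable_upto n (\<lambda>x. inverse (f x))"
    using Suc differentiable_upto_Suc_lower by blast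
  ultimately show ?case using Suc
    by (simp only: differentiable_upto.simps)
       (intro conjI allI differentiable_upto_mult differentiable_upto_const; auto)
qed auto

lemma differentiable_upto_sum:
  assumes "\<And>i. i \<in> I \<Longrightarrow> differentiable_upto n (f i)"
  shows "differentiable_upto n (\<lambda>x. \<Sum>i\<in>I. f i x)"
  using assms
  by (induction I rule: infinite_finite_induct)
     (auto intro!: differentiable_upto_add differentiable_upto_const)

lemma differentiable_upto_prod:
  assumes "\<And>i. i \<in> I \<Longrightarrow> differentiable_upto n (f i)"
  shows "differentiable_upto n (\<lambda>x. \<Prod>i\<in>I. f i x)"
  using assms
  by (induction I rule: infinite_finite_induct)
     (auto intro!: differentiable_upto_mult differentiable_upto_const)

lemma differentiable_upto_nth: "differentiable_upto n (\<lambda>x. of_real (x $ j))"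
proof -
  have D: "((\<lambda>x. complex_of_real (x $ j)) has_derivative (\<lambda>h. of_real (h $ j))) (at x)" for x
    by (intro bounded_linear_imp_has_derivative bounded_linear_compose[OF bounded_linear_of_real]
        bounded_linear_vec_nth)
  have "partial i (\<lambda>x. complex_of_real (x $ j)) = (\<lambda>x. of_real (axis i 1 $ j))" for i
    using partial_eqI[OF D] by auto
  then show ?thesis
    using D by (cases n) (auto simp: differentiable_def intro!: differentiable_upto_const)
qed

lemma smooth_add: "smooth f \<Longrightarrow> smooth g \<Longrightarrow> smooth (\<lambda>x. f x + g x)"
  and smooth_mult: "smooth f \<Longrightarrow> smooth g \<Longrightarrow> smooth (\<lambda>x. f x * g x)"
  and smooth_inverse: "smooth f \<Longrightarrow> (\<And>x. f x \<noteq> 0) \<Longrightarrow> smooth (\<lambda>x. inverse (f x))"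
  and smooth_prod: "(\<And>i. i \<in> I \<Longrightarrow> smooth (k i)) \<Longrightarrow> smooth (\<lambda>x. \<Prod>i\<in>I. k i x)"
  and smooth_const: "smooth (\<lambda>x. c)"
  and smooth_nth: "smooth (\<lambda>x. of_real (x $ j))"
  by (simp_all add: smooth_iff_differentiable_upto differentiable_upto_add differentiable_upto_mult
      differentiable_upto_inverse differentiable_upto_prod differentiable_upto_const
      differentiable_upto_nth)

lemma smooth_minus: "smooth f \<Longrightarrow> smooth (\<lambda>x. - f x)"
  using smooth_mult[OF smooth_const[of "-1"]] by simp

lemma smooth_imp_continuous: "smooth f \<Longrightarrow> continuous_on S f"
  by (meson continuous_at_imp_continuous_on differentiable_imp_continuous_within
      smooth_imp_differentiable)

subsection \<open>Smooth cutoff functions\<close>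

text \<open>\<open>flat 0\<close> is the classical flat function exp(-1/t). The powers of 1/t are
  included because derivatives of members of this family are linear combinations of members
  again.\<close>

definition flat :: "nat \<Rightarrow> real \<Rightarrow> real" where
  "flat k t = (if t > 0 then (1/t) ^ k * exp (- (1/t)) else 0)"

text \<open>With s = 1/t tending to infinity, the exponential beats every power of s.\<close>

lemma flat_right_limit: "(flat k \<longlongrightarrow> 0) (at_right 0)"
proof -
  have "((\<lambda>t. inverse t ^ k / exp (inverse t)) \<longlongrightarrow> (0::real)) (at_right 0)"
    using filterlim_compose[OF tendsto_power_div_exp_0 filterlim_inverse_at_top_right] .
  moreover have "\<forall>\<^sub>F t in at_right 0. inverse t ^ k / exp (inverse t) = flat k t"
    by (auto simp: eventually_at_right_field flat_def exp_minus divide_inverse intro!: exI[of _ 1])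
  ultimately show ?thesis by (rule Lim_transform_eventually)
qed

lemma has_real_derivative_flat:
  "(flat k has_real_derivative flat (k + 2) t - of_nat k * flat (k + 1) t) (at t)"
proof -
  consider "t > 0" | "t < 0" | "t = 0" by linarith
  then show ?thesis
  proof cases
    case 1
    have "((\<lambda>t. (1/t) ^ k * exp (- (1/t))) has_real_derivative
        flat (k + 2) t - of_nat k * flat (k + 1) t) (at t)"
      using 1
      by (auto intro!: derivative_eq_intros simp: flat_def)
         \<comment> \<open>The power rule yields the exponent \<open>k - 1\<close>, which is
           truncated at \<open>k = 0\<close>; hence the case split.\<close>
         (cases k; simp add: field_simps power2_eq_square)
    then show ?thesis
      by (rule has_field_derivative_transform_within_open[where S="{0<..}"])
         (use 1 in \<open>auto simp: flat_def\<close>)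
  next
    case 2
    have "((\<lambda>t. 0) has_real_derivative flat (k + 2) t - of_nat k * flat (k + 1) t) (at t)"
      using 2 by (simp add: flat_def)
    then show ?thesis
      by (rule has_field_derivative_transform_within_open[where S="{..<0}"])
         (use 2 in \<open>auto simp: flat_def\<close>)
  next
    case 3
    \<comment> \<open>For \<open>h > 0\<close> the difference quotient at the origin is
      \<open>flat (Suc k) h\<close>, so the limit is already known; for \<open>h < 0\<close> it is
      zero.\<close>
    have "((\<lambda>h. flat k h / h) \<longlongrightarrow> 0) (at_right 0)"
      by (rule Lim_transform_eventually[OF flat_right_limit[of "Suc k"]])
         (auto simp: eventually_at_right_field flat_def intro!: exI[of _ 1])
    moreover have "((\<lambda>h. flat k h / h) \<longlongrightarrow> 0) (at_left 0)"
      by (rule Lim_transform_eventually[OF tendsto_const])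
         (auto simp: eventually_at_left_field flat_def intro!: exI[of _ "-1"])
    ultimately have "((\<lambda>h. flat k h / h) \<longlongrightarrow> 0) (at 0)"
      by (simp add: filterlim_split_at)
    then show ?thesis
      using 3 by (simp add: DERIV_def flat_def)
  qed
qed

text \<open>Induction on the order with \<open>k\<close> arbitrary, since a derivative involves the
  indices \<open>k + 1\<close> and \<open>k + 2\<close>. The affine argument allows reflections
  (negative \<open>a\<close>), as the cutoffs require.\<close>

lemma differentiable_upto_flat_affine:
  "differentiable_upto n (\<lambda>x::real^'n::finite. complex_of_real (flat k (a * x $ j + b)))"
proof (induction n arbitrary: k)
  have D: "((\<lambda>x::real^'n. complex_of_real (flat k (a * x $ j + b))) has_derivative
     (\<lambda>h. of_real ((flat (k + 2) (a * x $ j + b) - of_nat k * flat (k + 1) (a * x $ j + b))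
       * (a * h $ j)))) (at x)" for x k
  proof -
    have "((\<lambda>x::real^'n. a * x $ j + b) has_derivative (\<lambda>h. a * h $ j)) (at x)"
      by (auto intro!: derivative_eq_intros bounded_linear_imp_has_derivative bounded_linear_vec_nth)
    from has_derivative_compose[OF this
        has_real_derivative_flat[of k "a * x $ j + b", unfolded has_field_derivative_def]]
    show ?thesis by (rule has_derivative_of_real)
  qed
  {
    case 0
    then show ?case using D by (auto simp: differentiable_def)
  next
    case (Suc n)
    have "partial i (\<lambda>x::real^'n. complex_of_real (flat k (a * x $ j + b))) =
      (\<lambda>x. of_real (a * axis i 1 $ j) * (of_real (flat (k + 2) (a * x $ j + b))
         + of_real (- of_nat k) * of_real (flat (k + 1) (a * x $ j + b))))" for i
      using partial_eqI[OF D] by (auto simp: algebra_simps)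
    moreover have "(\<lambda>x::real^'n. complex_of_real (flat k (a * x $ j + b))) differentiable (at x)" for x
      using D by (auto simp: differentiable_def)
    ultimately show ?case
      by (simp only: differentiable_upto.simps)
         (intro conjI allI differentiable_upto_add differentiable_upto_mult
           differentiable_upto_const Suc.IH; simp)
  }
qed

text \<open>The standard smooth transition from 0 to 1 on the unit interval. The denominator is
  positive because \<open>t\<close> and \<open>1 - t\<close> cannot both be nonpositive.\<close>

definition smooth_step :: "real \<Rightarrow> real" where
  "smooth_step t = flat 0 t * inverse (flat 0 t + flat 0 (1 - t))"

lemma smooth_step_eq_0: "t \<le> 0 \<Longrightarrow> smooth_step t = 0"
  by (simp add: smooth_step_def flat_def)

lemma smooth_step_eq_1: "t \<ge> 1 \<Longrightarrow> smooth_step t = 1"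
  by (simp add: smooth_step_def flat_def)

lemma smooth_smooth_step_affine:
  "smooth (\<lambda>x::real^'n::finite. complex_of_real (smooth_step (a * x $ j + b)))"
proof -
  have "flat 0 t + flat 0 (1 - t) \<noteq> 0" for t
    by (auto simp: flat_def add_pos_pos less_imp_neq[symmetric])
  then have nz: "complex_of_real (flat 0 t) + of_real (flat 0 (1 - t)) \<noteq> 0" for t
    by (metis of_real_add of_real_eq_0_iff)
  have fl: "smooth (\<lambda>x::real^'n. complex_of_real (flat 0 (a * x $ j + b)))" for a b
    by (simp add: smooth_iff_differentiable_upto differentiable_upto_flat_affine)
  have "smooth (\<lambda>x::real^'n. complex_of_real (flat 0 (1 - (a * x $ j + b))))"
    using fl[of "-a" "1 - b"] by (simp add: algebra_simps)
  then show ?thesis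
    unfolding smooth_step_def of_real_mult of_real_inverse of_real_add
    by (intro smooth_mult smooth_inverse smooth_add fl) (auto simp: nz)
qed

text \<open>In each coordinate the first factor falls from 1 to 0 as \<open>x $ j - a $ j\<close>
  runs from \<open>r / 2\<close> to \<open>r\<close>, and the second is its mirror image. Working
  with cubes instead of balls keeps the cutoff a product of functions of one coordinate.\<close>

definition cutoff :: "real^'n::finite \<Rightarrow> real \<Rightarrow> real^'n \<Rightarrow> complex" where
  "cutoff a r x = (\<Prod>j\<in>UNIV. of_real (smooth_step (2 - 2 * (x $ j - a $ j) / r))
      * of_real (smooth_step (2 + 2 * (x $ j - a $ j) / r)))"

lemma smooth_cutoff: "smooth (cutoff a r)"
proof -
  have 1: "smooth (\<lambda>x. complex_of_real (smooth_step (2 - 2 * (x $ j - a $ j) / r)))" for j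
    using smooth_smooth_step_affine[of "- 2 / r" j "2 + 2 * a $ j / r"]
    by (simp add: field_simps diff_divide_distrib)
  have 2: "smooth (\<lambda>x. complex_of_real (smooth_step (2 + 2 * (x $ j - a $ j) / r)))" for j
    using smooth_smooth_step_affine[of "2 / r" j "2 - 2 * a $ j / r"]
    by (simp add: field_simps diff_divide_distrib)
  show ?thesis
    unfolding cutoff_def[abs_def] by (intro smooth_prod smooth_mult 1 2)
qed

lemma cutoff_eq_1:
  assumes "r > 0" "\<And>j. \<bar>x $ j - a $ j\<bar> \<le> r / 2"
  shows "cutoff a r x = 1"
proof -
  have "2 - 2 * (x $ j - a $ j) / r \<ge> 1 \<and> 2 + 2 * (x $ j - a $ j) / r \<ge> 1" for j
    using assms(1) assms(2)[of j] by (simp add: field_simps abs_if split: if_splits)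
  then show ?thesis by (simp add: cutoff_def smooth_step_eq_1)
qed

lemma cutoff_nonzeroD:
  assumes "r > 0" "cutoff a r x \<noteq> 0"
  shows "\<bar>x $ j - a $ j\<bar> \<le> r"
proof (rule ccontr)
  assume "\<not> ?thesis"
  then have "2 - 2 * (x $ j - a $ j) / r \<le> 0 \<or> 2 + 2 * (x $ j - a $ j) / r \<le> 0"
    using assms(1) by (auto simp: field_simps)
  then have "smooth_step (2 - 2 * (x $ j - a $ j) / r) = 0 \<or>
      smooth_step (2 + 2 * (x $ j - a $ j) / r) = 0"
    using smooth_step_eq_0 by blast
  then have "cutoff a r x = 0"
    unfolding cutoff_def by (intro prod_zero bexI[of _ j]) auto
  with assms show False by simp
qed

subsection \<open>Supports of distributions\<close>

lemma tsupp_subset: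
  assumes "closed C" "\<And>x. f x \<noteq> 0 \<Longrightarrow> x \<in> C"
  shows "tsupp f \<subseteq> C"
  unfolding tsupp_def using assms by (intro closure_minimal) auto

lemma in_tsupp: "f x \<noteq> 0 \<Longrightarrow> x \<in> tsupp f"
  unfolding tsupp_def using closure_subset by fastforce

lemma test_funI:
  assumes "smooth f" "compact K" "\<And>x. f x \<noteq> 0 \<Longrightarrow> x \<in> K"
  shows "f \<in> test_fun"
proof -
  have "tsupp f \<subseteq> K" using assms by (intro tsupp_subset compact_imp_closed)
  then have "compact (tsupp f)"
    using assms(2) by (metis closed_closure compact_Int_closed inf.absorb_iff2 tsupp_def)
  with assms show ?thesis by (simp add: test_fun_def)
qed

lemma test_fun_smooth: "f \<in> test_fun \<Longrightarrow> smooth f"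
  and test_fun_compact: "f \<in> test_fun \<Longrightarrow> compact (tsupp f)"
  by (simp_all add: test_fun_def)

lemma test_fun_mult_smooth:
  assumes "f \<in> test_fun" "smooth h"
  shows "(\<lambda>x. f x * h x) \<in> test_fun"
  by (rule test_funI[of _ "tsupp f"])
     (use assms in \<open>auto simp: test_fun_compact test_fun_smooth intro: smooth_mult in_tsupp\<close>)

lemma tsupp_mult_subset: "tsupp (\<lambda>x. f x * h x) \<subseteq> tsupp f"
  unfolding tsupp_def by (intro closure_mono) auto

lemma partial_eq_0_outside_tsupp:
  assumes "x \<notin> tsupp f"
  shows "partial j f x = 0"
proof -
  have "((\<lambda>x. 0) has_derivative (\<lambda>h. 0)) (at x)" by simp
  then have "(f has_derivative (\<lambda>h. 0)) (at x)"
    by (rule has_derivative_transform_within_open[where s="- tsupp f"])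
       (use assms in_tsupp in \<open>auto simp: tsupp_def\<close>)
  from partial_eqI[OF this] show ?thesis .
qed

lemma test_fun_partial: "f \<in> test_fun \<Longrightarrow> partial j f \<in> test_fun"
  by (rule test_funI[of _ "tsupp f"])
     (use partial_eq_0_outside_tsupp in \<open>auto simp: test_fun_compact test_fun_smooth smooth_partial\<close>)

lemma test_fun_add:
  assumes "f \<in> test_fun" "g \<in> test_fun"
  shows "(\<lambda>x. f x + g x) \<in> test_fun"
proof (rule test_funI)
  show "x \<in> tsupp f \<union> tsupp g" if "f x + g x \<noteq> 0" for x
    using that in_tsupp[of f x] in_tsupp[of g x] by (cases "f x = 0") auto
qed (use assms in \<open>simp_all add: smooth_add test_fun_smooth test_fun_compact compact_Un\<close>)

lemma test_fun_euler_adj: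
  assumes "f \<in> test_fun"
  shows "euler_adj j f \<in> test_fun"
proof -
  have "(\<lambda>x. (f x + partial j f x * of_real (x $ j)) * (- 1)) \<in> test_fun"
    by (intro test_fun_mult_smooth test_fun_add test_fun_partial assms smooth_nth smooth_const)
  then show ?thesis by (simp add: euler_adj_def[abs_def] mult.commute)
qed

lemma test_fun_iter_euler_adj: "f \<in> test_fun \<Longrightarrow> iter_euler_adj js f \<in> test_fun"
  by (induction js) (auto simp: test_fun_euler_adj)

lemma test_fun_bounded:
  assumes "f \<in> test_fun"
  obtains B where "B \<ge> 0" "\<And>x. norm (f x) \<le> B"
proof -
  have "compact (f ` tsupp f)"
    using assms by (intro compact_continuous_image smooth_imp_continuous)
      (auto simp: test_fun_smooth test_fun_compact)
  then obtain B where B: "\<And>x. x \<in> tsupp f \<Longrightarrow> norm (f x) \<le> B"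
    by (meson bounded_iff compact_imp_bounded image_eqI)
  have "norm (f x) \<le> \<bar>B\<bar>" for x
    using B[of x] in_tsupp[of f x] by (cases "f x = 0") auto
  then show ?thesis using that[of "\<bar>B\<bar>"] by auto
qed

lemma open_cube: "open {x::real^'n::finite. \<forall>j. \<bar>x $ j - a $ j\<bar> < r}"
proof -
  have "{x::real^'n. \<forall>j. \<bar>x $ j - a $ j\<bar> < r} = (\<Inter>j. {x. \<bar>x $ j - a $ j\<bar> < r})"
    by auto
  then show ?thesis
    by (simp only:) (intro open_INT ballI open_Collect_less continuous_intros; simp)
qed

lemma distribution_add:
  "distribution T \<Longrightarrow> f \<in> test_fun \<Longrightarrow> g \<in> test_fun \<Longrightarrow> T (\<lambda>x. f x + g x) = T f + T g"
  by (simp add: distribution_def)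

text \<open>Splitting off one cutoff at a time (\<open>f = f h + f (1 - h)\<close>) replaces a partition of unity.\<close>

lemma distribution_eq_0_if_tsupp_covered:
  fixes T :: "(real^'n::finite \<Rightarrow> complex) \<Rightarrow> complex"
  assumes T: "distribution T" and "finite A" and r: "\<And>a. a \<in> A \<Longrightarrow> r a > 0"
    and loc: "\<And>a f. a \<in> A \<Longrightarrow> f \<in> test_fun \<Longrightarrow>
       tsupp f \<subseteq> {x. \<forall>j. \<bar>x $ j - a $ j\<bar> \<le> r a} \<Longrightarrow> T f = 0"
    and "f \<in> test_fun" "tsupp f \<subseteq> (\<Union>a\<in>A. {x. \<forall>j. \<bar>x $ j - a $ j\<bar> < r a / 2})"
  shows "T f = 0"
  using assms(2-)
proof (induction A arbitrary: f rule: finite_induct)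
  case empty
  then have "f = (\<lambda>x. 0)" using in_tsupp by fastforce
  moreover have "T (\<lambda>x. 0 * f x) = 0 * T f"
    using T empty.prems by (simp only: distribution_def)
  ultimately show ?case by simp
next
  case (insert a A)
  let ?h = "cutoff a (r a)"
  have ra: "r a > 0" using insert.prems by simp
  have sm: "smooth (\<lambda>x. 1 + - ?h x)"
    by (intro smooth_add smooth_minus smooth_const smooth_cutoff)
  have t1: "(\<lambda>x. f x * ?h x) \<in> test_fun" and t2: "(\<lambda>x. f x * (1 + - ?h x)) \<in> test_fun"
    using insert.prems by (intro test_fun_mult_smooth smooth_cutoff sm; simp)+
  have closed_cube: "closed {x::real^'n. \<forall>j. \<bar>x $ j - a $ j\<bar> \<le> r a}"
    by (intro closed_Collect_all closed_Collect_le continuous_intros)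
  have "T (\<lambda>x. f x * ?h x) = 0"
    using t1 by (rule insert.prems(2)[of a, simplified])
      (intro tsupp_subset closed_cube, use cutoff_nonzeroD[OF ra] in auto)
  moreover have "T (\<lambda>x. f x * (1 + - ?h x)) = 0"
  proof (rule insert.IH)
    \<comment> \<open>The cutoff is 1 on the open cube of half-width \<open>r a / 2\<close>, so
      \<open>f (1 - h)\<close> vanishes there. The complement of that cube is closed, hence contains
      the support, and the cubes around the remaining centres cover it.\<close>
    have "tsupp (\<lambda>x. f x * (1 + - ?h x)) \<subseteq> - {x. \<forall>j. \<bar>x $ j - a $ j\<bar> < r a / 2}"
    proof (rule tsupp_subset)
      show "closed (- {x. \<forall>j. \<bar>x $ j - a $ j\<bar> < r a / 2})"
        using open_cube by blast
      show "x \<in> - {x. \<forall>j. \<bar>x $ j - a $ j\<bar> < r a / 2}" if "f x * (1 + - ?h x) \<noteq> 0" for x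
        using that cutoff_eq_1[OF ra, of x a] less_imp_le by fastforce
    qed
    moreover have "tsupp (\<lambda>x. f x * (1 + - ?h x)) \<subseteq> tsupp f"
      by (rule tsupp_mult_subset)
    ultimately show "tsupp (\<lambda>x. f x * (1 + - ?h x)) \<subseteq>
        (\<Union>a\<in>A. {x. \<forall>j. \<bar>x $ j - a $ j\<bar> < r a / 2})"
      using insert.prems(4) unfolding UN_insert by blast
  qed (use t2 in \<open>auto intro: insert.prems(1,2)\<close>)
  moreover have "T (\<lambda>x. f x * ?h x + f x * (1 + - ?h x)) =
      T (\<lambda>x. f x * ?h x) + T (\<lambda>x. f x * (1 + - ?h x))"
    using T t1 t2 by (rule distribution_add)
  moreover have "(\<lambda>x. f x * ?h x + f x * (1 + - ?h x)) = f"
    by (simp add: algebra_simps)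
  ultimately show ?case by simp
qed

text \<open>The definition of \<open>dsupp\<close> provides vanishing only near each single point.
  Compactness of \<open>tsupp f\<close> leaves finitely many cubes to which the covering lemma
  applies.\<close>

lemma distribution_eq_0_if_tsupp_disjoint_dsupp:
  fixes T :: "(real^'n::finite \<Rightarrow> complex) \<Rightarrow> complex"
  assumes T: "distribution T" and f: "f \<in> test_fun" and dis: "tsupp f \<inter> dsupp T = {}"
  shows "T f = 0"
proof -
  have "\<exists>r>0. \<forall>g\<in>test_fun. tsupp g \<subseteq> {x. \<forall>j. \<bar>x $ j - a $ j\<bar> \<le> r} \<longrightarrow> T g = 0"
    if "a \<in> tsupp f" for a
  proof -
    from that dis obtain U where U: "open U" "a \<in> U" "\<forall>g\<in>test_fun. tsupp g \<subseteq> U \<longrightarrow> T g = 0"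
      unfolding dsupp_def by blast
    then obtain e where e: "e > 0" "ball a e \<subseteq> U" by (meson openE)
    \<comment> \<open>The sum of d coordinate differences of size at most \<open>r\<close> is then
      at most \<open>e / 2\<close>, so the closed cube fits into the open ball.\<close>
    define r where "r = e / (2 * CARD('n))"
    have "r > 0" using e by (simp add: r_def)
    moreover have "{x. \<forall>j. \<bar>x $ j - a $ j\<bar> \<le> r} \<subseteq> ball a e"
    proof clarsimp
      fix x assume x: "\<forall>j. \<bar>x $ j - a $ j\<bar> \<le> r"
      have "norm (x - a) \<le> (\<Sum>j\<in>UNIV. \<bar>(x - a) $ j\<bar>)" by (rule norm_le_l1_cart)
      also have "\<dots> \<le> (\<Sum>j\<in>(UNIV::'n set). r)" using x by (intro sum_mono) simp
      also have "\<dots> < e" using e by (simp add: r_def)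
      finally show "dist a x < e" by (simp add: dist_norm norm_minus_commute)
    qed
    ultimately show ?thesis using U e by (meson subset_trans)
  qed
  then have "\<forall>a\<in>tsupp f. \<exists>r>0. \<forall>g\<in>test_fun. tsupp g \<subseteq> {x. \<forall>j. \<bar>x $ j - a $ j\<bar> \<le> r} \<longrightarrow> T g = 0"
    by (rule ballI)
  from bchoice[OF this] obtain r where r: "\<forall>a\<in>tsupp f. r a > 0 \<and>
      (\<forall>g\<in>test_fun. tsupp g \<subseteq> {x. \<forall>j. \<bar>x $ j - a $ j\<bar> \<le> r a} \<longrightarrow> T g = 0)" ..
  have "tsupp f \<subseteq> (\<Union>a\<in>tsupp f. {x. \<forall>j. \<bar>x $ j - a $ j\<bar> < r a / 2})"
    using r by force
  then obtain A where A: "A \<subseteq> tsupp f" "finite A"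
    "tsupp f \<subseteq> (\<Union>a\<in>A. {x. \<forall>j. \<bar>x $ j - a $ j\<bar> < r a / 2})"
    by (rule compactE_image[OF test_fun_compact[OF f] open_cube])
  show ?thesis
    by (rule distribution_eq_0_if_tsupp_covered[OF T A(2) _ _ f A(3)]) (use A(1) r in \<open>blast intro: subsetD\<close>)+
qed

subsection \<open>Integrals with a dilation parameter\<close>

lemma norm_sum_nth_mult_le:
  assumes "\<And>j. norm (c j) \<le> B j"
  shows "norm (\<Sum>j\<in>UNIV. of_real (h $ j) * c j :: complex) \<le> (\<Sum>j\<in>UNIV. B j) * norm (h::real^'n::finite)"
proof -
  have "norm (\<Sum>j\<in>UNIV. of_real (h $ j) * c j) \<le> (\<Sum>j\<in>UNIV. norm (of_real (h $ j) * c j))"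
    by (rule norm_sum)
  also have "\<dots> \<le> (\<Sum>j\<in>UNIV. B j * norm h)"
  proof (rule sum_mono)
    fix j
    have "\<bar>h $ j\<bar> * norm (c j) \<le> norm h * B j"
      using assms component_le_norm_cart by (intro mult_mono) auto
    then show "norm (of_real (h $ j) * c j) \<le> B j * norm h"
      by (simp add: norm_mult mult.commute)
  qed
  finally show ?thesis by (simp add: sum_distrib_right)
qed

text \<open>Partial derivatives of a test function are test functions, hence bounded; the mean value
  inequality does the rest.\<close>

lemma test_fun_Lipschitz:
  fixes f :: "real^'n::finite \<Rightarrow> complex"
  assumes "f \<in> test_fun"
  obtains L where "L \<ge> 0" "\<And>x y. norm (f x - f y) \<le> L * norm (x - y)"
proof -
  have "\<exists>B\<ge>0. \<forall>x. norm (partial j f x) \<le> B" for j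
    using test_fun_bounded[OF test_fun_partial[OF assms, of j]] by metis
  then obtain B where B: "\<And>j. B j \<ge> 0" "\<And>j x. norm (partial j f x) \<le> B j" by metis
  show thesis
  proof (rule that[of "\<Sum>j\<in>UNIV. B j"])
    show "(\<Sum>j\<in>UNIV. B j) \<ge> 0" using B by (simp add: sum_nonneg)
    show "norm (f x - f y) \<le> (\<Sum>j\<in>UNIV. B j) * norm (x - y)" for x y
    proof (rule differentiable_bound[OF convex_UNIV])
      show "(f has_derivative (\<lambda>h. \<Sum>j\<in>UNIV. of_real (h $ j) * partial j f x)) (at x within UNIV)" for x
        using assms by (simp add: has_derivative_partial_sum smooth_imp_differentiable test_fun_smooth)
      show "onorm (\<lambda>h. \<Sum>j\<in>UNIV. of_real (h $ j) * partial j f x) \<le> (\<Sum>j\<in>UNIV. B j)" for x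
        using B by (intro onorm_le norm_sum_nth_mult_le)
    qed auto
  qed
qed

text \<open>The partial derivatives are Lipschitz, so on the ball of radius \<open>norm v\<close>
  about \<open>a\<close> the derivative stays within a multiple of \<open>norm v\<close> of its
  value at \<open>a\<close>. The mean value inequality for \<open>f\<close> minus its linearization
  contributes the second factor \<open>norm v\<close>.\<close>

lemma test_fun_Taylor_remainder:
  fixes f :: "real^'n::finite \<Rightarrow> complex"
  assumes "f \<in> test_fun"
  obtains M where "M \<ge> 0"
    "\<And>a v. norm (f (a + v) - f a - (\<Sum>j\<in>UNIV. of_real (v $ j) * partial j f a)) \<le> M * norm v ^ 2"
proof -
  have "\<exists>L\<ge>0. \<forall>x y. norm (partial j f x - partial j f y) \<le> L * norm (x - y)" for j
    using test_fun_Lipschitz[OF test_fun_partial[OF assms, of j]] by metis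
  then obtain L where L: "\<And>j. L j \<ge> 0"
    "\<And>j x y. norm (partial j f x - partial j f y) \<le> L j * norm (x - y)" by metis
  let ?D = "\<lambda>x h. \<Sum>j\<in>UNIV. of_real (h $ j) * partial j f x"
  show thesis
  proof (rule that[of "\<Sum>j\<in>UNIV. L j"])
    show "(\<Sum>j\<in>UNIV. L j) \<ge> 0" using L by (simp add: sum_nonneg)
    fix a v
    have "norm (f (a + v) - f a - ?D a (a + v - a)) \<le> norm (a + v - a) * (\<Sum>j\<in>UNIV. L j * norm v)"
    proof (rule differentiable_bound_linearization[where S="cball a (norm v)"])
      show "a + t *\<^sub>R (a + v - a) \<in> cball a (norm v)" if "t \<in> {0..1}" for t
        using that by (simp add: dist_norm mult_left_le_one_le)
      show "(f has_derivative ?D x) (at x within cball a (norm v))" for x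
        by (rule has_derivative_at_withinI, rule has_derivative_partial_sum)
           (use assms in \<open>simp add: smooth_imp_differentiable test_fun_smooth\<close>)
      show "onorm (?D x - ?D a) \<le> (\<Sum>j\<in>UNIV. L j * norm v)" if "x \<in> cball a (norm v)" for x
      proof (rule onorm_le)
        fix h
        have "norm (partial j f x - partial j f a) \<le> L j * norm v" for j
        proof -
          have "norm (x - a) \<le> norm v" using that by (simp add: dist_norm norm_minus_commute)
          then show ?thesis using L order_trans mult_left_mono by metis
        qed
        from norm_sum_nth_mult_le[of "\<lambda>j. partial j f x - partial j f a", OF this]
        show "norm ((?D x - ?D a) h) \<le> (\<Sum>j\<in>UNIV. L j * norm v) * norm h"
          by (simp add: algebra_simps sum_subtractf)
      qed
    qed auto
    then show "norm (f (a + v) - f a - ?D a v) \<le> (\<Sum>j\<in>UNIV. L j) * norm v ^ 2"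
      by (simp add: sum_distrib_right[symmetric] power2_eq_square mult_ac)
  qed
qed

lemma sum_axis_mult:
  "(\<Sum>i\<in>UNIV. complex_of_real (axis j 1 $ i) * c i) = c (j::'n::finite)"
proof -
  have "(\<Sum>i\<in>UNIV. complex_of_real (axis j 1 $ i) * c i) = (\<Sum>i\<in>UNIV. if i = j then c i else 0)"
    by (rule sum.cong) (auto simp: axis_def)
  then show ?thesis by simp
qed

section \<open>Weighted decay and integrability\<close>

definition decays :: "nat \<Rightarrow> (real^'n::finite \<Rightarrow> complex) \<Rightarrow> bool" where
  "decays k t \<longleftrightarrow> t \<in> borel_measurable lborel \<and>
     (\<exists>C. AE x in lborel. (1 + norm x ^ 2) powr (real k / 2) * norm (t x) \<le> C)"

lemma decays_measurable: "decays k t \<Longrightarrow> t \<in> borel_measurable lborel"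
  by (simp add: decays_def)

lemma decays_antimono:
  assumes "decays k t" "m \<le> k"
  shows "decays m t"
proof -
  obtain C where C: "AE x in lborel. (1 + norm x ^ 2) powr (real k / 2) * norm (t x) \<le> C"
    using assms(1) by (auto simp: decays_def)
  have "AE x in lborel. (1 + norm x ^ 2) powr (real m / 2) * norm (t x) \<le> C"
    using C
  proof (rule AE_mp, intro AE_I2 impI)
    fix x
    assume "(1 + norm x ^ 2) powr (real k / 2) * norm (t x) \<le> C"
    moreover have "(1 + norm x ^ 2) powr (real m / 2) \<le> (1 + norm x ^ 2) powr (real k / 2)"
      using assms(2) by (intro powr_mono) auto
    ultimately show "(1 + norm x ^ 2) powr (real m / 2) * norm (t x) \<le> C"
      by (meson mult_right_mono norm_ge_zero order_trans)
  qed
  then show ?thesis using assms(1) by (auto simp: decays_def)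
qed

text \<open>The weight \<open>(1 + norm x ^ 2) powr (1 / 2)\<close> dominates \<open>norm x\<close>,
  so a factor of at most linear growth costs exactly one order of decay.\<close>

lemma decays_mult:
  assumes "decays (Suc k) t" "g \<in> borel_measurable lborel" "\<And>x. norm (g x) \<le> norm x"
  shows "decays k (\<lambda>x. g x * t x)"
proof -
  obtain C where C: "AE x in lborel. (1 + norm x ^ 2) powr (real (Suc k) / 2) * norm (t x) \<le> C"
    using assms(1) by (auto simp: decays_def)
  have "AE x in lborel. (1 + norm x ^ 2) powr (real k / 2) * norm (g x * t x) \<le> C"
    using C
  proof (rule AE_mp, intro AE_I2 impI)
    fix x
    assume le: "(1 + norm x ^ 2) powr (real (Suc k) / 2) * norm (t x) \<le> C"
    have pos: "1 + norm x ^ 2 > 0" by (simp add: add_pos_nonneg)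
    have "norm (g x) \<le> sqrt (1 + norm x ^ 2)"
      using assms(3) real_le_rsqrt by (metis add.commute less_add_one less_imp_le order_trans)
    also have "\<dots> = (1 + norm x ^ 2) powr (1 / 2)" using pos by (simp add: powr_half_sqrt)
    finally have "(1 + norm x ^ 2) powr (real k / 2) * norm (g x)
        \<le> (1 + norm x ^ 2) powr (real k / 2) * (1 + norm x ^ 2) powr (1 / 2)"
      by (intro mult_left_mono) auto
    also have "\<dots> = (1 + norm x ^ 2) powr (real (Suc k) / 2)"
      by (simp add: powr_add[symmetric] add_divide_distrib add.commute)
    finally show "(1 + norm x ^ 2) powr (real k / 2) * norm (g x * t x) \<le> C"
      using le by (simp add: norm_mult mult.assoc[symmetric]) (meson mult_right_mono norm_ge_zero order_trans)
  qed
  then show ?thesis using assms decays_measurable[OF assms(1)] by (auto simp: decays_def)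
qed

text \<open>By Tonelli the integral factors into one-dimensional integrals of
  \<open>inverse (1 + x^2)\<close>, each of which is finite.\<close>

lemma integrable_prod_inverse_1_plus_square:
  "integrable lborel (\<lambda>x::'a::euclidean_space. \<Prod>b\<in>Basis. inverse (1 + (x \<bullet> b)^2))"
proof (rule integrableI_nonneg)
  have "integrable lborel (\<lambda>x::real. inverse (1 + x^2))"
    using integrable_inverse_1_plus_square by (simp add: set_integrable_def)
  then have fin: "(\<integral>\<^sup>+x. ennreal (inverse (1 + x^2)) \<partial>lborel) < \<infinity>"
    by (simp add: integrable_iff_bounded)
  have "(\<integral>\<^sup>+x. ennreal (\<Prod>b\<in>Basis. inverse (1 + (x \<bullet> b)^2)) \<partial>(lborel::'a measure)) =
      (\<integral>\<^sup>+x. (\<Prod>b\<in>Basis. ennreal (inverse (1 + (x \<bullet> b)^2))) \<partial>(lborel::'a measure))"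
    by (simp add: prod_ennreal)
  also have "\<dots> = (\<Prod>b\<in>(Basis::'a set). (\<integral>\<^sup>+x. ennreal (inverse (1 + x^2)) \<partial>lborel))"
    by (rule nn_integral_lborel_prod) auto
  also have "\<dots> < \<infinity>"
    using fin by (simp add: power_less_top_ennreal)
  finally show "(\<integral>\<^sup>+x. ennreal (\<Prod>b\<in>Basis. inverse (1 + (x \<bullet> b)^2)) \<partial>(lborel::'a measure)) < \<infinity>" .
qed (auto intro!: AE_I2 prod_nonneg)

text \<open>The exponent \<open>2 d\<close> is not optimal; it allows comparison with a product of one-dimensional
  integrands via \<open>(1 + |x|\<^sup>2)\<^sup>d \<ge> \<Prod>\<^sub>j (1 + x\<^sub>j\<^sup>2)\<close>.\<close>

lemma integrable_decays:
  fixes t :: "real^'n::finite \<Rightarrow> complex"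
  assumes "decays (2 * CARD('n)) t"
  shows "integrable lborel t"
proof -
  let ?w = "\<lambda>x::real^'n. \<Prod>b\<in>Basis. inverse (1 + (x \<bullet> b)^2)"
  obtain C where "AE x in lborel. (1 + norm x ^ 2) powr (real (2 * CARD('n)) / 2) * norm (t x) \<le> C"
    using assms by (auto simp: decays_def)
  then have "AE x in lborel. norm (t x) \<le> norm (C * ?w x)"
  proof (rule AE_mp, intro AE_I2 impI)
    fix x :: "real^'n"
    assume le: "(1 + norm x ^ 2) powr (real (2 * CARD('n)) / 2) * norm (t x) \<le> C"
    have pos: "1 + norm x ^ 2 > 0" by (simp add: add_pos_nonneg)
    have "(\<Prod>b\<in>Basis. 1 + (x \<bullet> b)^2) \<le> (\<Prod>b\<in>(Basis::(real^'n) set). 1 + norm x ^ 2)"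
    proof (rule prod_mono)
      fix b :: "real^'n" assume "b \<in> Basis"
      then have "\<bar>x \<bullet> b\<bar> \<le> norm x" by (rule Basis_le_norm)
      then have "(x \<bullet> b)^2 \<le> norm x ^ 2" by (metis abs_ge_zero power2_abs power_mono)
      then show "0 \<le> 1 + (x \<bullet> b)^2 \<and> 1 + (x \<bullet> b)^2 \<le> 1 + norm x ^ 2" by simp
    qed
    also have "\<dots> = (1 + norm x ^ 2) powr (real (2 * CARD('n)) / 2)"
      using pos by (simp add: powr_realpow)
    finally have "(\<Prod>b\<in>Basis. 1 + (x \<bullet> b)^2) * norm (t x) \<le> C"
      using le by (meson mult_right_mono norm_ge_zero order_trans)
    moreover have "(\<Prod>b\<in>Basis. 1 + (x \<bullet> b)^2) > 0"
      by (intro prod_pos) (simp add: add_pos_nonneg)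
    ultimately have "norm (t x) \<le> C / (\<Prod>b\<in>Basis. 1 + (x \<bullet> b)^2)"
      by (simp add: field_simps)
    also have "\<dots> = C * ?w x"
      using prod_inversef[of "\<lambda>b. 1 + (x \<bullet> b)^2" Basis] by (simp add: o_def divide_inverse)
    finally have "norm (t x) \<le> C * ?w x" .
    then show "norm (t x) \<le> norm (C * ?w x)" by simp
  qed
  then show ?thesis
    using decays_measurable[OF assms]
    by (intro Bochner_Integration.integrable_bound[OF
        integrable_mult_right[OF integrable_prod_inverse_1_plus_square]])
qed

text \<open>A quadratic remainder makes the normalized error at most \<open>C * norm h\<close>,
  which tends to zero.\<close>

lemma has_derivativeI_quadratic:
  fixes f :: "'a::real_normed_vector \<Rightarrow> 'b::real_normed_vector"
  assumes "bounded_linear D" "\<And>h. norm (f (x + h) - f x - D h) \<le> C * norm h ^ 2"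
  shows "(f has_derivative D) (at x)"
  unfolding has_derivative_at
proof
  have "((\<lambda>h::'a. C * norm h) \<longlongrightarrow> 0) (at 0)"
    by (intro tendsto_mult_right_zero tendsto_norm_zero tendsto_ident_at)
  then show "((\<lambda>h. norm (f (x + h) - f x - D h) / norm h) \<longlongrightarrow> 0) (at 0)"
  proof (rule Lim_null_comparison[rotated], intro always_eventually allI)
    fix h
    show "norm (norm (f (x + h) - f x - D h) / norm h) \<le> C * norm h"
      using assms(2)[of h] by (cases "h = 0") (auto simp: field_simps power2_eq_square)
  qed
qed fact

section \<open>Differentiating integrals of dilated test functions in the dilation parameter\<close>

lemma coord_mult_nth [simp]: "coord_mult a b $ j = a $ j * b $ j"
  by (simp add: coord_mult_def)

lemma coord_mult_add_right: "coord_mult a (b + c) = coord_mult a b + coord_mult a c"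
  by (simp add: vec_eq_iff algebra_simps)

lemma norm_coord_mult_le: "norm (coord_mult a b) \<le> norm a * norm b"
proof -
  have "norm (coord_mult a b) \<le> norm (norm a *\<^sub>R b)"
    by (rule norm_le_componentwise_cart) (simp add: abs_mult mult_right_mono component_le_norm_cart)
  then show ?thesis by simp
qed

lemma continuous_on_coord_mult_left: "continuous_on S (\<lambda>x. coord_mult x y)"
  unfolding coord_mult_def by (intro continuous_intros)

text \<open>Boundedness of \<open>f\<close> alone gives a multiple of \<open>norm (t \<xi>)\<close>
  as majorant. Hence \<open>y\<close> may have vanishing coordinates, where the dilated function can
  lose its compact support.\<close>

lemma integrable_decays_dilation:
  fixes t :: "real^'n::finite \<Rightarrow> complex"
  assumes t: "decays (2 * CARD('n)) t" and f: "f \<in> test_fun"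
  shows "integrable lborel (\<lambda>\<xi>. t \<xi> * f (coord_mult \<xi> y))"
proof -
  obtain B where B: "B \<ge> 0" "\<And>x. norm (f x) \<le> B" using test_fun_bounded[OF f] by metis
  have "continuous_on UNIV (\<lambda>\<xi>. f (coord_mult \<xi> y))"
    using smooth_imp_continuous[OF test_fun_smooth[OF f]] continuous_on_coord_mult_left
    by (rule continuous_on_compose2) auto
  then have [measurable]: "(\<lambda>\<xi>. f (coord_mult \<xi> y)) \<in> borel_measurable lborel"
    by (simp add: borel_measurable_continuous_onI)
  note [measurable] = decays_measurable[OF t]
  show ?thesis
  proof (rule Bochner_Integration.integrable_bound[OF integrable_mult_right[OF integrable_decays[OF t], of "of_real B"]])
    show "AE \<xi> in lborel. norm (t \<xi> * f (coord_mult \<xi> y)) \<le> norm (complex_of_real B * t \<xi>)"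
      using B by (intro AE_I2) (simp add: norm_mult mult.commute[of B] mult_left_mono)
  qed measurable
qed

lemma borel_measurable_of_real_nth:
  "(\<lambda>x::real^'n::finite. complex_of_real (x $ j)) \<in> borel_measurable lborel"
  by (simp add: borel_measurable_continuous_onI continuous_intros)

text \<open>Two orders of decay beyond integrability are spent on the quadratic Taylor remainder, which
  makes dominated convergence unnecessary.\<close>

lemma has_derivative_dilation_integral:
  fixes t :: "real^'n::finite \<Rightarrow> complex"
  assumes t: "decays (2 * CARD('n) + 2) t" and f: "f \<in> test_fun"
  shows "((\<lambda>y. \<integral>\<xi>. t \<xi> * f (coord_mult \<xi> y) \<partial>lborel) has_derivative
    (\<lambda>h. \<Sum>j\<in>UNIV. of_real (h $ j) *
       (\<integral>\<xi>. (of_real (\<xi> $ j) * t \<xi>) * partial j f (coord_mult \<xi> y) \<partial>lborel))) (at y)"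
proof -
  let ?p = "\<lambda>j \<xi>. (of_real (\<xi> $ j) * t \<xi>) * partial j f (coord_mult \<xi> y)"
  obtain M where M: "M \<ge> 0"
    "\<And>a v. norm (f (a + v) - f a - (\<Sum>j\<in>UNIV. of_real (v $ j) * partial j f a)) \<le> M * norm v ^ 2"
    using test_fun_Taylor_remainder[OF f] by metis
  \<comment> \<open>Multiplying twice by \<open>norm x\<close> spends the two extra orders of decay,
    leaving the order that guarantees integrability.\<close>
  have "decays (2 * CARD('n)) (\<lambda>x. of_real (norm x) * (of_real (norm x) * t x))"
    using t by (intro decays_mult) auto
  then have "integrable lborel (\<lambda>x. norm (complex_of_real (norm x) * (of_real (norm x) * t x)))"
    by (intro integrable_norm integrable_decays)
  then have int2: "integrable lborel (\<lambda>x. norm x ^ 2 * norm (t x))"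
    by (simp add: norm_mult power2_eq_square mult.assoc)
  have int0: "integrable lborel (\<lambda>\<xi>. t \<xi> * f (coord_mult \<xi> z))" for z
    using f by (intro integrable_decays_dilation decays_antimono[OF t]) auto
  have dec1: "decays (Suc (2 * CARD('n))) t"
    using t by (rule decays_antimono) simp
  have int1: "integrable lborel (?p j)" for j
    using f borel_measurable_of_real_nth
    by (intro integrable_decays_dilation test_fun_partial decays_mult[OF dec1])
       (auto simp: component_le_norm_cart)
  show ?thesis
  proof (rule has_derivativeI_quadratic)
    show "bounded_linear (\<lambda>h::real^'n. \<Sum>j\<in>UNIV. of_real (h $ j) * (\<integral>\<xi>. ?p j \<xi> \<partial>lborel))"
      by (intro bounded_linear_sum bounded_linear_mult_left[THEN bounded_linear_compose]
          bounded_linear_of_real[THEN bounded_linear_compose] bounded_linear_vec_nth)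
    fix h
    let ?R = "\<lambda>\<xi>. t \<xi> * f (coord_mult \<xi> (y + h)) - t \<xi> * f (coord_mult \<xi> y)
        - (\<Sum>j\<in>UNIV. of_real (h $ j) * ?p j \<xi>)"
    have intR: "integrable lborel ?R"
      by (intro Bochner_Integration.integrable_diff int0 Bochner_Integration.integrable_sum
          integrable_mult_right int1)
    have le: "norm (?R \<xi>) \<le> M * norm h ^ 2 * (norm \<xi> ^ 2 * norm (t \<xi>))" for \<xi>
    proof -
      let ?a = "coord_mult \<xi> y" and ?v = "coord_mult \<xi> h"
      \<comment> \<open>The increment of the argument is \<open>\<xi> h\<close>, so its factor
        \<open>\<xi> $ j\<close> can be moved over to \<open>t\<close>: the integrand is
        \<open>t\<close> times the Taylor remainder of \<open>f\<close> at
        \<open>\<xi> y\<close>.\<close>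
      have "?R \<xi> = t \<xi> * (f (?a + ?v) - f ?a - (\<Sum>j\<in>UNIV. of_real (?v $ j) * partial j f ?a))"
        by (simp add: coord_mult_add_right algebra_simps sum_distrib_left)
      then have "norm (?R \<xi>) \<le> norm (t \<xi>) * (M * norm ?v ^ 2)"
        by (simp only: norm_mult) (intro mult_left_mono M; simp)
      also have "\<dots> \<le> norm (t \<xi>) * (M * (norm \<xi> * norm h) ^ 2)"
        using M(1) by (intro mult_left_mono power_mono norm_coord_mult_le) auto
      finally show ?thesis by (simp add: power_mult_distrib mult_ac)
    qed
    have "(\<integral>\<xi>. t \<xi> * f (coord_mult \<xi> (y + h)) \<partial>lborel) - (\<integral>\<xi>. t \<xi> * f (coord_mult \<xi> y) \<partial>lborel)
        - (\<Sum>j\<in>UNIV. of_real (h $ j) * (\<integral>\<xi>. ?p j \<xi> \<partial>lborel)) = integral\<^sup>L lborel ?R"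
      by (simp add: int0 int1)
    also have "norm \<dots> \<le> (\<integral>\<xi>. M * norm h ^ 2 * (norm \<xi> ^ 2 * norm (t \<xi>)) \<partial>lborel)"
      by (rule order_trans[OF integral_norm_bound])
         (intro integral_mono integrable_norm intR integrable_mult_right int2 le)
    also have "\<dots> = (M * (\<integral>\<xi>. norm \<xi> ^ 2 * norm (t \<xi>) \<partial>lborel)) * norm h ^ 2"
      by simp
    finally show "norm ((\<integral>\<xi>. t \<xi> * f (coord_mult \<xi> (y + h)) \<partial>lborel)
        - (\<integral>\<xi>. t \<xi> * f (coord_mult \<xi> y) \<partial>lborel)
        - (\<Sum>j\<in>UNIV. of_real (h $ j) * (\<integral>\<xi>. ?p j \<xi> \<partial>lborel)))
        \<le> (M * (\<integral>\<xi>. norm \<xi> ^ 2 * norm (t \<xi>) \<partial>lborel)) * norm h ^ 2" .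
  qed
qed

text \<open>A partial derivative of the integral is an integral of the same form, with
  \<open>t\<close> multiplied by \<open>\<xi> $ j\<close> and \<open>f\<close> replaced by
  \<open>partial j f\<close>. The induction therefore varies both, losing one order of decay per
  step.\<close>

lemma differentiable_upto_dilation_integral:
  fixes t :: "real^'n::finite \<Rightarrow> complex"
  assumes "decays (2 * CARD('n) + 2 + N) t" and "f \<in> test_fun"
  shows "differentiable_upto N (\<lambda>y. \<integral>\<xi>. t \<xi> * f (coord_mult \<xi> y) \<partial>lborel)"
  using assms
proof (induction N arbitrary: t f)
  case 0
  then show ?case
    using has_derivative_dilation_integral by (auto simp: differentiable_def)
next
  case (Suc N)
  have dec: "decays (2 * CARD('n) + 2) t"
    using Suc.prems(1) by (rule decays_antimono) simp
  note D = has_derivative_dilation_integral[OF dec Suc.prems(2)]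
  have "partial j (\<lambda>y. \<integral>\<xi>. t \<xi> * f (coord_mult \<xi> y) \<partial>lborel) =
      (\<lambda>y. \<integral>\<xi>. (of_real (\<xi> $ j) * t \<xi>) * partial j f (coord_mult \<xi> y) \<partial>lborel)" for j
    using partial_eqI[OF D, of j] by (auto simp: sum_axis_mult)
  moreover have "differentiable_upto N
      (\<lambda>y. \<integral>\<xi>. (of_real (\<xi> $ j) * t \<xi>) * partial j f (coord_mult \<xi> y) \<partial>lborel)" for j
    using Suc.prems borel_measurable_of_real_nth
    by (intro Suc.IH decays_mult test_fun_partial) (auto simp: component_le_norm_cart)
  ultimately show ?case using D by (auto simp: differentiable_def)
qed

subsection \<open>Dilations of test functions\<close>

lemma has_derivative_coord_mult_left:
  "((\<lambda>x. coord_mult x y) has_derivative (\<lambda>h. coord_mult h y)) (at x)"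
proof -
  have "linear (\<lambda>h. coord_mult h y)"
    by (rule linearI) (simp_all add: vec_eq_iff algebra_simps)
  then show ?thesis
    by (intro bounded_linear_imp_has_derivative linear_conv_bounded_linear[THEN iffD1])
qed

lemma has_derivative_dilation:
  fixes f :: "real^'n::finite \<Rightarrow> complex"
  assumes "\<And>x. f differentiable (at x)"
  shows "((\<lambda>\<xi>. f (coord_mult \<xi> y)) has_derivative
    (\<lambda>h. \<Sum>j\<in>UNIV. of_real (h $ j * y $ j) * partial j f (coord_mult x y))) (at x)"
  using has_derivative_compose[OF has_derivative_coord_mult_left has_derivative_partial_sum[OF assms]]
  by simp

lemma partial_dilation:
  fixes f :: "real^'n::finite \<Rightarrow> complex"
  assumes "\<And>x. f differentiable (at x)"
  shows "partial j (\<lambda>\<xi>. f (coord_mult \<xi> y)) x = of_real (y $ j) * partial j f (coord_mult x y)"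
proof -
  have "partial j (\<lambda>\<xi>. f (coord_mult \<xi> y)) x =
      (\<Sum>i\<in>UNIV. of_real (axis j 1 $ i * y $ i) * partial i f (coord_mult x y))"
    by (rule partial_eqI[OF has_derivative_dilation[OF assms]])
  then show ?thesis by (simp only: of_real_mult mult.assoc sum_axis_mult)
qed

lemma differentiable_upto_dilation:
  "differentiable_upto n f \<Longrightarrow> differentiable_upto n (\<lambda>\<xi>. f (coord_mult \<xi> y))"
proof (induction n arbitrary: f)
  case 0
  then have "\<And>x. f differentiable (at x)" by simp
  from has_derivative_dilation[OF this] show ?case
    unfolding differentiable_upto.simps differentiable_def by blast
next
  case (Suc n)
  then have d: "\<And>x. f differentiable (at x)" by simp
  have "partial j (\<lambda>\<xi>. f (coord_mult \<xi> y)) = (\<lambda>x. of_real (y $ j) * partial j f (coord_mult x y))" for j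
    using partial_dilation[OF d] by blast
  moreover have "(\<lambda>\<xi>. f (coord_mult \<xi> y)) differentiable (at x)" for x
    using has_derivative_dilation[OF d] differentiable_def by blast
  ultimately show ?case
    using Suc by (auto intro!: differentiable_upto_mult differentiable_upto_const)
qed

lemma test_fun_box:
  fixes f :: "real^'n::finite \<Rightarrow> complex"
  assumes "f \<in> test_fun"
  obtains R where "R > 0" "\<And>x j. f x \<noteq> 0 \<Longrightarrow> \<bar>x $ j\<bar> \<le> R"
proof -
  obtain R where "\<And>x. x \<in> tsupp f \<Longrightarrow> norm x \<le> R"
    using test_fun_compact[OF assms] by (meson bounded_iff compact_imp_bounded)
  then have "\<bar>x $ j\<bar> \<le> \<bar>R\<bar> + 1" if "f x \<noteq> 0" for x j
    using in_tsupp[of f x, OF that] component_le_norm_cart[of x j] by fastforce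
  then show thesis using that[of "\<bar>R\<bar> + 1"] by auto
qed

text \<open>The bound may depend on the coordinate because a dilation by \<open>y\<close> stretches
  each axis by its own factor.\<close>

lemma test_funI_box:
  fixes f :: "real^'n::finite \<Rightarrow> complex"
  assumes "smooth f" "\<And>x j. f x \<noteq> 0 \<Longrightarrow> \<bar>x $ j\<bar> \<le> R j"
  shows "f \<in> test_fun"
proof (rule test_funI[OF assms(1) compact_cbox])
  show "x \<in> cbox (\<chi> j. - R j) (\<chi> j. R j)" if "f x \<noteq> 0" for x
    unfolding mem_box_cart using assms(2)[OF that] by (auto simp: abs_le_iff minus_le_iff)
qed

lemma test_fun_dilation:
  assumes "f \<in> test_fun" "\<And>j. y $ j \<noteq> 0"
  shows "(\<lambda>\<xi>. f (coord_mult \<xi> y)) \<in> test_fun"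
proof -
  obtain R where R: "R > 0" "\<And>x j. f x \<noteq> 0 \<Longrightarrow> \<bar>x $ j\<bar> \<le> R"
    using test_fun_box[OF assms(1)] by metis
  show ?thesis
  proof (rule test_funI_box)
    show "smooth (\<lambda>\<xi>. f (coord_mult \<xi> y))"
      using test_fun_smooth[OF assms(1)]
      by (simp add: smooth_iff_differentiable_upto differentiable_upto_dilation)
    show "\<bar>x $ j\<bar> \<le> R / \<bar>y $ j\<bar>" if "f (coord_mult x y) \<noteq> 0" for x j
      using R(2)[OF that, of j] assms(2)[of j] by (simp add: field_simps abs_mult)
  qed
qed

text \<open>The factor \<open>y $ j\<close> produced by the chain rule combines with the coefficient
  \<open>\<xi> $ j\<close> of the Euler operator into the coordinate of
  \<open>\<xi> y\<close>.\<close>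

lemma euler_adj_dilation:
  assumes "\<And>x. f differentiable (at x)"
  shows "euler_adj j (\<lambda>\<xi>. f (coord_mult \<xi> y)) = (\<lambda>\<xi>. euler_adj j f (coord_mult \<xi> y))"
proof
  fix x
  show "euler_adj j (\<lambda>\<xi>. f (coord_mult \<xi> y)) x = euler_adj j f (coord_mult x y)"
    unfolding euler_adj_def partial_dilation[OF assms] by (simp add: mult.assoc)
qed

lemma iter_euler_adj_dilation:
  assumes "f \<in> test_fun"
  shows "iter_euler_adj js (\<lambda>\<xi>. f (coord_mult \<xi> y)) = (\<lambda>\<xi>. iter_euler_adj js f (coord_mult \<xi> y))"
proof (induction js)
  case (Cons j js)
  have "\<And>x. iter_euler_adj js f differentiable (at x)"
    by (intro smooth_imp_differentiable test_fun_smooth test_fun_iter_euler_adj assms)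
  note euler_adj_dilation[OF this, of j y]
  then show ?case unfolding iter_euler_adj.simps Cons.IH .
qed simp

section \<open>Smooth extension and support of the dilated pairing\<close>

lemma OH_representation:
  assumes "T \<in> OH"
  shows "\<exists>F t. finite F \<and> (\<forall>js\<in>F. decays k (t js)) \<and>
    (\<forall>f\<in>test_fun. T f = (\<Sum>js\<in>F. \<integral>x. t js x * iter_euler_adj js f x \<partial>lborel))"
  \<comment> \<open>\<open>decays\<close> repeats the condition inside \<open>OH\<close> literally,
    so after unfolding only the instance at \<open>k\<close> has to be picked out.\<close>
  using assms unfolding OH_def decays_def mem_Collect_eq by (rule conjunct2[THEN spec])

lemma OH_dilation_differentiable_upto:
  fixes T :: "(real^'n::finite \<Rightarrow> complex) \<Rightarrow> complex"
  assumes "T \<in> OH" and f: "f \<in> test_fun"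
  shows "\<exists>g. differentiable_upto N g \<and>
    (\<forall>y. (\<forall>j. y $ j \<noteq> 0) \<longrightarrow> T (\<lambda>\<xi>. f (coord_mult \<xi> y)) = g y)"
proof -
  \<comment> \<open>The order of decay adds up from 2 d for integrability, 2 for the Taylor
    remainder, and one for each of the \<open>N\<close> derivatives.\<close>
  obtain F t where dec: "\<forall>js\<in>F. decays (2 * CARD('n) + 2 + N) (t js)"
    and T: "\<forall>f\<in>test_fun. T f = (\<Sum>js\<in>F. \<integral>x. t js x * iter_euler_adj js f x \<partial>lborel)"
    using OH_representation[OF assms(1), of "2 * CARD('n) + 2 + N"] by (elim exE conjE)
  let ?g = "\<lambda>y. \<Sum>js\<in>F. \<integral>\<xi>. t js \<xi> * iter_euler_adj js f (coord_mult \<xi> y) \<partial>lborel"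
  have "differentiable_upto N ?g"
    by (intro differentiable_upto_sum differentiable_upto_dilation_integral dec[rule_format]
        test_fun_iter_euler_adj f)
  moreover have "T (\<lambda>\<xi>. f (coord_mult \<xi> y)) = ?g y" if "\<forall>j. y $ j \<noteq> 0" for y
    using T[rule_format, OF test_fun_dilation[OF f]] that
    by (simp add: iter_euler_adj_dilation[OF f])
  ultimately show ?thesis by blast
qed

text \<open>Moving from \<open>y\<close> along the diagonal, where \<open>1\<close> is the all-ones
  vector, leaves every coordinate hyperplane for small positive \<open>d\<close>. This makes density
  of the points without zero coordinates explicit.\<close>

lemma eventually_add_const_nonzero:
  "\<forall>\<^sub>F d in at_right (0::real). \<forall>j. ((y::real^'n::finite) + d *\<^sub>R 1) $ j \<noteq> 0"
proof -
  have "\<forall>\<^sub>F d in at_right 0. y $ j + d \<noteq> 0" for j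
  proof (cases "y $ j < 0")
    case True
    then show ?thesis by (auto simp: eventually_at_right_field intro!: exI[of _ "- y $ j"])
  next
    case False
    then show ?thesis by (auto simp: eventually_at_right_field intro!: exI[of _ 1])
  qed
  then show ?thesis by (simp add: eventually_all_finite)
qed

lemma tendsto_add_const_at_right:
  fixes f :: "real^'n::finite \<Rightarrow> complex"
  assumes "continuous_on UNIV f"
  shows "((\<lambda>d. f (y + d *\<^sub>R 1)) \<longlongrightarrow> f y) (at_right 0)"
proof -
  have "continuous_on UNIV (\<lambda>d. f (y + d *\<^sub>R 1))"
    by (rule continuous_on_compose2[OF assms]) (auto intro!: continuous_intros)
  then have "isCont (\<lambda>d. f (y + d *\<^sub>R 1)) 0"
    by (simp add: continuous_on_eq_continuous_at)
  then have "((\<lambda>d. f (y + d *\<^sub>R 1)) \<longlongrightarrow> f (y + 0 *\<^sub>R 1)) (at 0)"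
    by (simp only: isCont_def)
  then show ?thesis by (simp add: filterlim_at_split)
qed

lemma continuous_eq_if_eq_on_nonzero:
  fixes f g :: "real^'n::finite \<Rightarrow> complex"
  assumes "continuous_on UNIV f" "continuous_on UNIV g" "\<And>y. \<forall>j. y $ j \<noteq> 0 \<Longrightarrow> f y = g y"
  shows "f = g"
proof
  fix y
  have "((\<lambda>d. f (y + d *\<^sub>R 1)) \<longlongrightarrow> g y) (at_right 0)"
    by (rule Lim_transform_eventually[OF tendsto_add_const_at_right[OF assms(2)]],
        rule eventually_mono[OF eventually_add_const_nonzero[of y]]) (simp add: assms(3))
  then show "f y = g y"
    using tendsto_add_const_at_right[OF assms(1), of y] tendsto_unique by (metis trivial_limit_at_right_real)
qed

lemma differentiable_upto_continuous: "differentiable_upto n f \<Longrightarrow> continuous_on S f"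
  by (meson continuous_at_imp_continuous_on differentiable_imp_continuous_within
      differentiable_upto_imp_differentiable)

lemma OH_dilation_smooth:
  fixes T :: "(real^'n::finite \<Rightarrow> complex) \<Rightarrow> complex"
  assumes "T \<in> OH" and "f \<in> test_fun"
  obtains g where "smooth g" "\<And>y. \<forall>j. y $ j \<noteq> 0 \<Longrightarrow> T (\<lambda>\<xi>. f (coord_mult \<xi> y)) = g y"
proof -
  obtain G where G: "\<And>N. differentiable_upto N (G N)"
    "\<And>N y. \<forall>j. y $ j \<noteq> 0 \<Longrightarrow> T (\<lambda>\<xi>. f (coord_mult \<xi> y)) = G N y"
    using OH_dilation_differentiable_upto[OF assms] by metis
  \<comment> \<open>The representation, and with it \<open>G N\<close>, is chosen anew for each
    \<open>N\<close>; continuity forces all these extensions to coincide, so \<open>G 0\<close>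
    inherits every order of differentiability.\<close>
  have "G N = G 0" for N
    by (rule continuous_eq_if_eq_on_nonzero)
       (use G differentiable_upto_continuous in \<open>blast, blast, metis\<close>)
  then have "smooth (G 0)"
    using G(1) by (metis smooth_iff_differentiable_upto)
  then show thesis using that G(2) by blast
qed

lemma distribution_dilation_eq_0:
  fixes T :: "(real^'n::finite \<Rightarrow> complex) \<Rightarrow> complex"
  assumes T: "distribution T" "dsupp T \<subseteq> W \<epsilon>" and "\<epsilon> > 0" and f: "f \<in> test_fun"
    and R: "\<And>x. f x \<noteq> 0 \<Longrightarrow> \<bar>x $ i\<bar> \<le> R"
    and y: "\<And>j. y $ j \<noteq> 0" "\<bar>y $ i\<bar> > R / \<epsilon>"
  shows "T (\<lambda>\<xi>. f (coord_mult \<xi> y)) = 0"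
proof (rule distribution_eq_0_if_tsupp_disjoint_dsupp[OF T(1) test_fun_dilation[OF f y(1)]])
  \<comment> \<open>The bound on one coordinate is a closed condition, so it passes from the nonzero
    set to its closure.\<close>
  have "tsupp (\<lambda>\<xi>. f (coord_mult \<xi> y)) \<subseteq> {\<xi>. \<bar>\<xi> $ i\<bar> * \<bar>y $ i\<bar> \<le> R}"
  proof (rule tsupp_subset)
    show "closed {\<xi>. \<bar>\<xi> $ i\<bar> * \<bar>y $ i\<bar> \<le> R}"
      by (intro closed_Collect_le continuous_intros)
  qed (use R in \<open>force simp: abs_mult\<close>)
  moreover have "R < \<bar>\<xi> $ i\<bar> * \<bar>y $ i\<bar>" if "\<xi> \<in> W \<epsilon>" for \<xi>
  proof -
    have "R < \<epsilon> * \<bar>y $ i\<bar>" using y(2) \<open>\<epsilon> > 0\<close> by (simp add: field_simps)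
    also have "\<dots> \<le> \<bar>\<xi> $ i\<bar> * \<bar>y $ i\<bar>" using that by (simp add: W_def mult_right_mono)
    finally show ?thesis .
  qed
  ultimately show "tsupp (\<lambda>\<xi>. f (coord_mult \<xi> y)) \<inter> dsupp T = {}"
    using T(2) by fastforce
qed

theorem theorem2:
  fixes T :: "(real^'n::finite \<Rightarrow> complex) \<Rightarrow> complex" and \<epsilon> :: real
  assumes "T \<in> OH" and "\<epsilon> > 0" and "dsupp T \<subseteq> W \<epsilon>"
  shows "T \<in> DH"
proof -
  have T: "distribution T" using assms(1) by (simp add: OH_def)
  have "\<exists>\<psi>\<in>test_fun. \<forall>y. (\<forall>j. y $ j \<noteq> 0) \<longrightarrow> T (\<lambda>\<xi>. \<phi> (coord_mult \<xi> y)) = \<psi> y"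
    if \<phi>: "\<phi> \<in> test_fun" for \<phi>
  proof -
    obtain \<psi> where \<psi>: "smooth \<psi>" "\<And>y. \<forall>j. y $ j \<noteq> 0 \<Longrightarrow> T (\<lambda>\<xi>. \<phi> (coord_mult \<xi> y)) = \<psi> y"
      using OH_dilation_smooth[OF assms(1) \<phi>] by metis
    obtain R where R: "R > 0" "\<And>x j. \<phi> x \<noteq> 0 \<Longrightarrow> \<bar>x $ j\<bar> \<le> R"
      using test_fun_box[OF \<phi>] by metis
    have "\<bar>y $ i\<bar> \<le> R / \<epsilon>" if "\<psi> y \<noteq> 0" for y i
    proof (rule ccontr)
      assume "\<not> ?thesis"
      then have gt: "R / \<epsilon> < \<bar>y $ i\<bar>" by simp
      \<comment> \<open>\<open>T\<close> is evaluated only at points without zero coordinates, while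
        \<open>y\<close> may have some. The strict inequality survives a small diagonal shift, so
        \<open>\<psi>\<close> vanishes at the shifted points and, by continuity, at
        \<open>y\<close>.\<close>
      have "((\<lambda>d. \<bar>(y + d *\<^sub>R 1) $ i\<bar>) \<longlongrightarrow> \<bar>(y + 0 *\<^sub>R 1) $ i\<bar>) (at_right 0)"
        by (intro tendsto_intros)
      then have "\<forall>\<^sub>F d in at_right 0. R / \<epsilon> < \<bar>(y + d *\<^sub>R 1) $ i\<bar>"
        by (rule order_tendstoD(1)) (use gt in simp)
      then have "\<forall>\<^sub>F d in at_right 0. 0 = \<psi> (y + d *\<^sub>R 1)"
        using eventually_add_const_nonzero[of y]
      proof eventually_elim
        case (elim d)
        then show ?case
          using distribution_dilation_eq_0[OF T assms(3,2) \<phi> R(2), where i=i and y="y + d *\<^sub>R 1"] \<psi>(2)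
          by simp
      qed
      then have "((\<lambda>d. \<psi> (y + d *\<^sub>R 1)) \<longlongrightarrow> 0) (at_right 0)"
        by (rule Lim_transform_eventually[OF tendsto_const])
      then have "\<psi> y = 0"
        using tendsto_add_const_at_right[OF smooth_imp_continuous[OF \<psi>(1)], of y] tendsto_unique
        by (metis trivial_limit_at_right_real)
      with that show False by simp
    qed
    then have "\<psi> \<in> test_fun" by (intro test_funI_box[OF \<psi>(1)])
    with \<psi>(2) show ?thesis by blast
  qed
  with T show ?thesis by (simp add: DH_def)
qed

end
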